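(* Let $n\ge1$ and let $X\subseteq\mathbb{FT}^n$ be a tropical polytope. Then $X$ is a projective $\mathbb{FT}$-module if and only if $X$ has generator dimension equal to its dual dimension (equal to $k$, say), and $X$ is isomorphic as an $\mathbb{FT}$-module to a submodule of $\mathbb{FT}^k$ that is min-plus convex (as well as max-plus convex).
   Context: $\mathbb{FT}$ is the finitary tropical semiring: the set $\mathbb{R}$ with $a \oplus b = \max(a,b)$ and $a \otimes b = ab = a+b$ (usual addition); its multiplicative identity is the real number $0$. An $\mathbb{FT}$-module is a commutative semigroup $(M,\oplus)$ with a left action of $\mathbb{FT}$ satisfying $\lambda(\mu m) = (\lambda\mu)m$, $(\lambda\oplus\mu)m = \lambda m\oplus\mu m$, $\lambda(m\oplus m') = \lambda m\oplus\lambda m'$ and $0m = m$. Morphisms are maps preserving $\oplus$ and the action. $\mathbb{FT}^n$ is an $\mathbb{FT}$-module under componentwise maximum and $(\lambda x)_i = \lambda + x_i$, and is partially ordered componentwise. A tropical polytope in $\mathbb{FT}^n$ is a non-empty finitely generated submodule of $\mathbb{FT}^n$ (generated under $\oplus$ and scaling by $\mathbb{FT}$). A subset of $\mathbb{FT}^k$ is max-plus convex if it is closed under $\oplus$ and scaling by $\mathbb{FT}$, i.e. is a submodule, and min-plus convex if it is closed under componentwise minimum and scaling by $\mathbb{FT}$. A module $P$ is projective if for every morphism $g : P \to M$ and every surjective morphism $f : A \to M$ of $\mathbb{FT}$-modules there is a morphism $p : P \to A$ with $f \circ p = g$. The generator dimension of $X$ is the minimal cardinality of a generating set of $X$ under scaling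 and $\oplus$. The dual dimension of $X$ is the minimal cardinality of a generating set of $X$ under scaling and the operation of greatest lower bound within the poset $X$ (which may differ from the componentwise minimum). *)

theory Defs
  imports Complex_Main "HOL-Library.FuncSet" "HOL-Library.Extended_Nat"
begin

section \<open>Modules over the finitary tropical semiring\<close>

text \<open>
  The finitary tropical semiring is carried by the type of real numbers: its addition is
  \<^const>\<open>max\<close>, its multiplication is \<open>+\<close>, and its multiplicative identity is \<open>0\<close>.
  It has no additive identity, so a module is only a commutative semigroup (possibly empty).
\<close>

record 'a ft_struct =
  ft_carrier :: "'a set"
  ft_add :: "'a \<Rightarrow> 'a \<Rightarrow> 'a"
  ft_scale :: "real \<Rightarrow> 'a \<Rightarrow> 'a"

locale ft_module =
  fixes M :: "'a ft_struct"
  assumes add_closed: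
      "\<lbrakk>x \<in> ft_carrier M; y \<in> ft_carrier M\<rbrakk> \<Longrightarrow> ft_add M x y \<in> ft_carrier M"
    and add_assoc:
      "\<lbrakk>x \<in> ft_carrier M; y \<in> ft_carrier M; z \<in> ft_carrier M\<rbrakk>
        \<Longrightarrow> ft_add M (ft_add M x y) z = ft_add M x (ft_add M y z)"
    and add_commute:
      "\<lbrakk>x \<in> ft_carrier M; y \<in> ft_carrier M\<rbrakk> \<Longrightarrow> ft_add M x y = ft_add M y x"
    and scale_closed:
      "x \<in> ft_carrier M \<Longrightarrow> ft_scale M a x \<in> ft_carrier M"
    and scale_scale:
      "x \<in> ft_carrier M \<Longrightarrow> ft_scale M a (ft_scale M b x) = ft_scale M (a + b) x"
    and scale_max:
      "x \<in> ft_carrier M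
        \<Longrightarrow> ft_scale M (max a b) x = ft_add M (ft_scale M a x) (ft_scale M b x)"
    and scale_add:
      "\<lbrakk>x \<in> ft_carrier M; y \<in> ft_carrier M\<rbrakk>
        \<Longrightarrow> ft_scale M a (ft_add M x y) = ft_add M (ft_scale M a x) (ft_scale M a y)"
    and scale_0:
      "x \<in> ft_carrier M \<Longrightarrow> ft_scale M 0 x = x"

definition ft_hom :: "'a ft_struct \<Rightarrow> 'b ft_struct \<Rightarrow> ('a \<Rightarrow> 'b) set" where
  "ft_hom M N = {f. f \<in> ft_carrier M \<rightarrow> ft_carrier N
     \<and> (\<forall>x\<in>ft_carrier M. \<forall>y\<in>ft_carrier M. f (ft_add M x y) = ft_add N (f x) (f y))
     \<and> (\<forall>a. \<forall>x\<in>ft_carrier M. f (ft_scale M a x) = ft_scale N a (f x))}"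

definition ft_isomorphic :: "'a ft_struct \<Rightarrow> 'b ft_struct \<Rightarrow> bool" where
  "ft_isomorphic M N \<longleftrightarrow> (\<exists>f\<in>ft_hom M N. bij_betw f (ft_carrier M) (ft_carrier N))"

text \<open>
  HOL cannot quantify over all types inside a formula. Projectivity is therefore expressed by the
  lifting property against all surjections between modules whose elements are of type \<open>'u\<close>.
  Every set of at most the cardinality of \<open>'u\<close> has a copy inside \<open>'u\<close>, so \<open>'u\<close> acts as a universe;
  it must not be too small (over \<^typ>\<open>unit\<close> every module satisfies the property).
\<close>

definition ft_projective :: "'u itself \<Rightarrow> 'a ft_struct \<Rightarrow> bool" where
  "ft_projective U P \<longleftrightarrow> ft_module P \<and>
     (\<forall>(A :: 'u ft_struct) (M :: 'u ft_struct) f g.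
        ft_module A \<and> ft_module M \<and> g \<in> ft_hom P M
          \<and> f \<in> ft_hom A M \<and> f ` ft_carrier A = ft_carrier M
        \<longrightarrow> (\<exists>p\<in>ft_hom P A. \<forall>x\<in>ft_carrier P. f (p x) = g x))"

inductive_set ft_span :: "'a ft_struct \<Rightarrow> 'a set \<Rightarrow> 'a set"
  for M :: "'a ft_struct" and S :: "'a set" where
  gen: "x \<in> S \<Longrightarrow> x \<in> ft_span M S"
| add: "\<lbrakk>x \<in> ft_span M S; y \<in> ft_span M S\<rbrakk> \<Longrightarrow> ft_add M x y \<in> ft_span M S"
| scale: "x \<in> ft_span M S \<Longrightarrow> ft_scale M a x \<in> ft_span M S"

text \<open>The value is \<open>\<infinity>\<close> if there is no finite generating set; likewise for \<open>dual_dim\<close> below.\<close>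

definition generator_dim :: "'a ft_struct \<Rightarrow> enat" where
  "generator_dim M =
     (INF S\<in>{S. finite S \<and> S \<subseteq> ft_carrier M \<and> ft_span M S = ft_carrier M}. enat (card S))"


section \<open>Submodules of finite powers\<close>

text \<open>
  Vectors with \<open>n\<close> entries are the functions on \<open>{..<n}\<close>, made unique by the value
  \<^const>\<open>undefined\<close> outside \<open>{..<n}\<close>. \<open>FT n X\<close> is the subset \<open>X\<close> with the operations of the
  \<open>n\<close>-th power.
\<close>

definition ft_vecs :: "nat \<Rightarrow> (nat \<Rightarrow> real) set" where
  "ft_vecs n = {..<n} \<rightarrow>\<^sub>E UNIV"

definition vec_max :: "nat \<Rightarrow> (nat \<Rightarrow> real) \<Rightarrow> (nat \<Rightarrow> real) \<Rightarrow> (nat \<Rightarrow> real)" where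
  "vec_max n x y = (\<lambda>i\<in>{..<n}. max (x i) (y i))"

definition vec_min :: "nat \<Rightarrow> (nat \<Rightarrow> real) \<Rightarrow> (nat \<Rightarrow> real) \<Rightarrow> (nat \<Rightarrow> real)" where
  "vec_min n x y = (\<lambda>i\<in>{..<n}. min (x i) (y i))"

definition vec_scale :: "nat \<Rightarrow> real \<Rightarrow> (nat \<Rightarrow> real) \<Rightarrow> (nat \<Rightarrow> real)" where
  "vec_scale n a x = (\<lambda>i\<in>{..<n}. a + x i)"

definition vec_le :: "nat \<Rightarrow> (nat \<Rightarrow> real) \<Rightarrow> (nat \<Rightarrow> real) \<Rightarrow> bool" where
  "vec_le n x y \<longleftrightarrow> (\<forall>i<n. x i \<le> y i)"

definition FT :: "nat \<Rightarrow> (nat \<Rightarrow> real) set \<Rightarrow> (nat \<Rightarrow> real) ft_struct" where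
  "FT n X = \<lparr>ft_carrier = X, ft_add = vec_max n, ft_scale = vec_scale n\<rparr>"

definition max_plus_convex :: "nat \<Rightarrow> (nat \<Rightarrow> real) set \<Rightarrow> bool" where
  "max_plus_convex n X \<longleftrightarrow> X \<subseteq> ft_vecs n
     \<and> (\<forall>x\<in>X. \<forall>y\<in>X. vec_max n x y \<in> X) \<and> (\<forall>a. \<forall>x\<in>X. vec_scale n a x \<in> X)"

definition min_plus_convex :: "nat \<Rightarrow> (nat \<Rightarrow> real) set \<Rightarrow> bool" where
  "min_plus_convex n X \<longleftrightarrow> X \<subseteq> ft_vecs n
     \<and> (\<forall>x\<in>X. \<forall>y\<in>X. vec_min n x y \<in> X) \<and> (\<forall>a. \<forall>x\<in>X. vec_scale n a x \<in> X)"

definition tropical_polytope :: "nat \<Rightarrow> (nat \<Rightarrow> real) set \<Rightarrow> bool" where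
  "tropical_polytope n X \<longleftrightarrow> X \<noteq> {} \<and> max_plus_convex n X
     \<and> (\<exists>S. finite S \<and> S \<subseteq> X \<and> ft_span (FT n X) S = X)"

text \<open>
  Greatest lower bounds are taken within the poset \<open>X\<close>, so they may lie strictly below the
  componentwise minimum.
\<close>

definition is_glb_in :: "nat \<Rightarrow> (nat \<Rightarrow> real) set \<Rightarrow> (nat \<Rightarrow> real) \<Rightarrow> (nat \<Rightarrow> real) \<Rightarrow> (nat \<Rightarrow> real) \<Rightarrow> bool"
  where
  "is_glb_in n X x y z \<longleftrightarrow> z \<in> X \<and> vec_le n z x \<and> vec_le n z y
     \<and> (\<forall>w\<in>X. vec_le n w x \<and> vec_le n w y \<longrightarrow> vec_le n w z)"

inductive_set dual_span :: "nat \<Rightarrow> (nat \<Rightarrow> real) set \<Rightarrow> (nat \<Rightarrow> real) set \<Rightarrow> (nat \<Rightarrow> real) set"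
  for n :: nat and X :: "(nat \<Rightarrow> real) set" and S :: "(nat \<Rightarrow> real) set" where
  gen: "x \<in> S \<Longrightarrow> x \<in> dual_span n X S"
| glb: "\<lbrakk>x \<in> dual_span n X S; y \<in> dual_span n X S; is_glb_in n X x y z\<rbrakk> \<Longrightarrow> z \<in> dual_span n X S"
| scale: "x \<in> dual_span n X S \<Longrightarrow> vec_scale n a x \<in> dual_span n X S"

definition dual_dim :: "nat \<Rightarrow> (nat \<Rightarrow> real) set \<Rightarrow> enat" where
  "dual_dim n X = (INF S\<in>{S. finite S \<and> S \<subseteq> X \<and> dual_span n X S = X}. enat (card S))"

end

(*
  If X is projective and s_0, ..., s_m is a generating set of minimal size, the identity of X lifts
  along the surjection f from FT^(m+1) to X given by the s_j, to a morphism p. The matrix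
  e i j = p (s_j) i satisfies e i j + e j l <= e i l, and e j j = 0 by minimality; hence p X is the
  set of all y with e i j + y j <= y i, which is closed under minima. The negated rows of e
  generate p X under minima, and none of them can be dispensed with: they are meet-irreducible, and
  proportional rows would give proportional generators.

  Conversely, in a finitely generated Y in FT^k that is closed under minima there is, for each j, a
  least element c_j among those with j-th entry 0, and every y in Y is the combination of the c_j
  with its own entries as coefficients. So y |-> (+) y_j a_j lifts a morphism as soon as each a_j
  lifts the image of c_j.
*)

theory Submission
  imports Defs
begin

section \<open>Finite sums in modules\<close>

text \<open>With no additive identity there is no empty sum, so \<open>m\<close> is the last index:
  the terms are \<open>t 0\<close> up to \<open>t m\<close>.\<close>

primrec ft_sum :: "'a ft_struct \<Rightarrow> (nat \<Rightarrow> 'a) \<Rightarrow> nat \<Rightarrow> 'a" where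
  "ft_sum M t 0 = t 0"
| "ft_sum M t (Suc m) = ft_add M (ft_sum M t m) (t (Suc m))"

definition ft_comb :: "'a ft_struct \<Rightarrow> (nat \<Rightarrow> 'a) \<Rightarrow> nat \<Rightarrow> (nat \<Rightarrow> real) \<Rightarrow> 'a" where
  "ft_comb M a m x = ft_sum M (\<lambda>j. ft_scale M (x j) (a j)) m"

lemma ft_hom_closed: "\<lbrakk>f \<in> ft_hom M N; x \<in> ft_carrier M\<rbrakk> \<Longrightarrow> f x \<in> ft_carrier N"
  by (auto simp: ft_hom_def)

lemma ft_hom_add:
  "\<lbrakk>f \<in> ft_hom M N; x \<in> ft_carrier M; y \<in> ft_carrier M\<rbrakk> \<Longrightarrow> f (ft_add M x y) = ft_add N (f x) (f y)"
  by (auto simp: ft_hom_def)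

lemma ft_hom_scale:
  "\<lbrakk>f \<in> ft_hom M N; x \<in> ft_carrier M\<rbrakk> \<Longrightarrow> f (ft_scale M a x) = ft_scale N a (f x)"
  by (auto simp: ft_hom_def)

lemma ft_hom_comp:
  "\<lbrakk>f \<in> ft_hom L M; g \<in> ft_hom M N\<rbrakk> \<Longrightarrow> (\<lambda>x. g (f x)) \<in> ft_hom L N"
  by (auto simp: ft_hom_def Pi_iff)

lemma ft_sum_cong: "(\<And>j. j \<le> m \<Longrightarrow> s j = t j) \<Longrightarrow> ft_sum M s m = ft_sum M t m"
  by (induction m) auto

lemma ft_sum_in_span: "(\<And>j. j \<le> m \<Longrightarrow> t j \<in> ft_span M S) \<Longrightarrow> ft_sum M t m \<in> ft_span M S"
  by (induction m) (auto intro: ft_span.add)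

lemma ft_span_subset:
  assumes "S \<subseteq> ft_span M T"
  shows "ft_span M S \<subseteq> ft_span M T"
proof
  fix x assume "x \<in> ft_span M S"
  then show "x \<in> ft_span M T"
    by induction (use assms in \<open>auto intro: ft_span.add ft_span.scale\<close>)
qed

text \<open>Nothing can be derived without a generator; hence a finite generating set of a non-empty
  module has \<open>Suc m\<close> elements for some \<open>m\<close>, as \<open>ft_sum\<close>
  requires.\<close>

lemma ft_span_empty: "ft_span M {} = {}"
proof -
  have "x \<in> ft_span M {} \<Longrightarrow> False" for x
    by (induction rule: ft_span.induct) auto
  then show ?thesis by blast
qed

context ft_module
begin

lemma ft_sum_closed: "(\<And>j. j \<le> m \<Longrightarrow> t j \<in> ft_carrier M) \<Longrightarrow> ft_sum M t m \<in> ft_carrier M"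
  by (induction m) (auto intro: add_closed)

lemma ft_comb_closed: "(\<And>j. j \<le> m \<Longrightarrow> a j \<in> ft_carrier M) \<Longrightarrow> ft_comb M a m x \<in> ft_carrier M"
  unfolding ft_comb_def by (intro ft_sum_closed scale_closed)

lemma add_left_commute:
  assumes "x \<in> ft_carrier M" "y \<in> ft_carrier M" "z \<in> ft_carrier M"
  shows "ft_add M x (ft_add M y z) = ft_add M y (ft_add M x z)"
  using assms by (metis add_assoc add_commute)

lemma add_add_swap:
  assumes "x \<in> ft_carrier M" "y \<in> ft_carrier M" "z \<in> ft_carrier M" "w \<in> ft_carrier M"
  shows "ft_add M (ft_add M x y) (ft_add M z w) = ft_add M (ft_add M x z) (ft_add M y w)"
  using assms by (simp add: add_assoc add_left_commute add_closed)

lemma ft_sum_add: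
  "\<lbrakk>\<And>j. j \<le> m \<Longrightarrow> s j \<in> ft_carrier M; \<And>j. j \<le> m \<Longrightarrow> t j \<in> ft_carrier M\<rbrakk>
    \<Longrightarrow> ft_sum M (\<lambda>j. ft_add M (s j) (t j)) m = ft_add M (ft_sum M s m) (ft_sum M t m)"
proof (induction m)
  case (Suc m)
  then show ?case by (simp add: add_add_swap ft_sum_closed)
qed simp

lemma ft_sum_scale:
  "(\<And>j. j \<le> m \<Longrightarrow> t j \<in> ft_carrier M)
    \<Longrightarrow> ft_sum M (\<lambda>j. ft_scale M a (t j)) m = ft_scale M a (ft_sum M t m)"
  by (induction m) (simp_all add: scale_add ft_sum_closed)

lemma ft_hom_sum:
  "\<lbrakk>f \<in> ft_hom M N; \<And>j. j \<le> m \<Longrightarrow> t j \<in> ft_carrier M\<rbrakk>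
    \<Longrightarrow> f (ft_sum M t m) = ft_sum N (\<lambda>j. f (t j)) m"
  by (induction m) (simp_all add: ft_hom_add ft_sum_closed)

lemma ft_hom_comb:
  assumes "f \<in> ft_hom M N" "\<And>j. j \<le> m \<Longrightarrow> a j \<in> ft_carrier M"
  shows "f (ft_comb M a m x) = ft_comb N (\<lambda>j. f (a j)) m x"
proof -
  have "f (ft_comb M a m x) = ft_sum N (\<lambda>j. f (ft_scale M (x j) (a j))) m"
    unfolding ft_comb_def by (intro ft_hom_sum assms scale_closed)
  also have "\<dots> = ft_comb N (\<lambda>j. f (a j)) m x"
    unfolding ft_comb_def by (intro ft_sum_cong) (simp add: ft_hom_scale assms)
  finally show ?thesis .
qed

end


section \<open>Submodules of finite powers\<close>

lemma FT_simps [simp]: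
  "ft_carrier (FT n X) = X" "ft_add (FT n X) = vec_max n" "ft_scale (FT n X) = vec_scale n"
  by (simp_all add: FT_def)

lemma vec_apply [simp]:
  "i < n \<Longrightarrow> vec_max n x y i = max (x i) (y i)"
  "i < n \<Longrightarrow> vec_min n x y i = min (x i) (y i)"
  "i < n \<Longrightarrow> vec_scale n a x i = a + x i"
  by (simp_all add: vec_max_def vec_min_def vec_scale_def)

lemma vec_in_ft_vecs [simp]:
  "vec_max n x y \<in> ft_vecs n" "vec_min n x y \<in> ft_vecs n" "vec_scale n a x \<in> ft_vecs n"
  by (simp_all add: vec_max_def vec_min_def vec_scale_def ft_vecs_def)

lemma ft_vecs_eqI:
  "\<lbrakk>x \<in> ft_vecs n; y \<in> ft_vecs n; \<And>i. i < n \<Longrightarrow> x i = y i\<rbrakk> \<Longrightarrow> x = y"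
  unfolding ft_vecs_def by (rule PiE_ext) auto

lemma max_plus_convex_ft_vecs: "max_plus_convex n (ft_vecs n)"
  by (simp add: max_plus_convex_def)

lemma ft_module_FT:
  assumes "max_plus_convex n X"
  shows "ft_module (FT n X)"
proof -
  have "x \<in> ft_vecs n" if "x \<in> X" for x
    using assms that by (auto simp: max_plus_convex_def)
  then show ?thesis
    using assms unfolding max_plus_convex_def
    by unfold_locales (auto intro!: ft_vecs_eqI[of _ n])
qed

lemma ft_sum_FT_ge: "\<lbrakk>j \<le> m; i < n\<rbrakk> \<Longrightarrow> t j i \<le> ft_sum (FT n X) t m i"
  by (induction m) (auto simp: le_Suc_eq intro: max.coboundedI1)

lemma ft_sum_FT_attained: "i < n \<Longrightarrow> \<exists>j\<le>m. ft_sum (FT n X) t m i = t j i"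
proof (induction m)
  case (Suc m)
  then obtain j where j: "j \<le> m" "ft_sum (FT n X) t m i = t j i" by blast
  then have "ft_sum (FT n X) t (Suc m) i = (if t j i \<le> t (Suc m) i then t (Suc m) i else t j i)"
    using Suc.prems by (simp add: max_def)
  then show ?case using j(1) by (metis le_SucI order_refl)
qed simp

section \<open>Combinations with real coefficients\<close>

lemma ft_comb_FT_ge: "\<lbrakk>j \<le> m; i < n\<rbrakk> \<Longrightarrow> x j + a j i \<le> ft_comb (FT n X) a m x i"
  using ft_sum_FT_ge[of j m i n "\<lambda>j. vec_scale n (x j) (a j)"] by (simp add: ft_comb_def)

lemma ft_comb_FT_attained: "i < n \<Longrightarrow> \<exists>j\<le>m. ft_comb (FT n X) a m x i = x j + a j i"
  using ft_sum_FT_attained[of i n m X "\<lambda>j. vec_scale n (x j) (a j)"] by (simp add: ft_comb_def)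

lemma ft_comb_in_vecs: "ft_comb (FT n X) a m x \<in> ft_vecs n"
  by (cases m) (simp_all add: ft_comb_def)

text \<open>An upper bound of the terms that is attained in every entry is their componentwise
  maximum.\<close>

lemma ft_comb_FT_eqI:
  assumes "y \<in> ft_vecs n"
    and "\<And>i j. \<lbrakk>i < n; j \<le> m\<rbrakk> \<Longrightarrow> x j + a j i \<le> y i"
    and "\<And>i. i < n \<Longrightarrow> \<exists>j\<le>m. y i = x j + a j i"
  shows "ft_comb (FT n X) a m x = y"
proof (rule ft_vecs_eqI[OF ft_comb_in_vecs assms(1)])
  fix i assume i: "i < n"
  obtain j j' where "j \<le> m" "ft_comb (FT n X) a m x i = x j + a j i"
    and "j' \<le> m" "y i = x j' + a j' i"
    using ft_comb_FT_attained[OF i] assms(3)[OF i] by metis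
  then show "ft_comb (FT n X) a m x i = y i"
    using assms(2)[OF i, of j] ft_comb_FT_ge[of j' m i n x a X] i by auto
qed

text \<open>Freeness of the module FT^(m+1): \<open>scale_max\<close> and \<open>scale_scale\<close>
  turn the operations on coefficients into those of \<open>M\<close>. The set \<open>Y\<close> is
  left open so that submodules of the free module are covered.\<close>

lemma ft_comb_hom:
  assumes "ft_module M" "\<And>j. j \<le> m \<Longrightarrow> a j \<in> ft_carrier M"
  shows "ft_comb M a m \<in> ft_hom (FT (Suc m) Y) M"
proof -
  interpret ft_module M by fact
  have "ft_comb M a m (vec_max (Suc m) x y) = ft_add M (ft_comb M a m x) (ft_comb M a m y)" for x y
    unfolding ft_comb_def
    by (subst ft_sum_add[symmetric])
      (auto intro!: ft_sum_cong simp: assms scale_closed scale_max)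
  moreover have "ft_comb M a m (vec_scale (Suc m) c x) = ft_scale M c (ft_comb M a m x)" for c x
    unfolding ft_comb_def
    by (subst ft_sum_scale[symmetric])
      (auto intro!: ft_sum_cong simp: assms scale_closed scale_scale)
  ultimately show ?thesis
    by (auto simp: ft_hom_def assms ft_comb_closed)
qed

text \<open>
  All coefficients have to be finite: a generator that is not needed gets a coefficient small
  enough not to contribute, which exists because all entries are finite.
\<close>

lemma span_FT_comb:
  assumes "n \<ge> 1" "S \<subseteq> ft_vecs n" "S = s ` {..m}" "x \<in> ft_span (FT n X) S"
  shows "\<exists>c \<in> ft_vecs (Suc m). ft_comb (FT n Y) s m c = x"
proof -
  have "s j \<in> ft_vecs n" if "j \<le> m" for j using that assms(2,3) by auto
  then have "ft_comb (FT n (ft_vecs n)) s m \<in> ft_hom (FT (Suc m) (ft_vecs (Suc m))) (FT n (ft_vecs n))"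
    by (intro ft_comb_hom ft_module_FT max_plus_convex_ft_vecs) auto
  \<comment> \<open>\<open>ft_comb\<close> refers only to the operations, not to the carrier, so
    \<open>Y\<close> can be exchanged for all of \<open>ft_vecs n\<close>.\<close>
  moreover have "ft_comb (FT n (ft_vecs n)) s m = ft_comb (FT n Y) s m"
  proof -
    have "ft_sum (FT n (ft_vecs n)) t l = ft_sum (FT n Y) t l" for t l by (induction l) auto
    then show ?thesis by (auto simp: ft_comb_def fun_eq_iff)
  qed
  ultimately have hom: "ft_comb (FT n Y) s m \<in> ft_hom (FT (Suc m) (ft_vecs (Suc m))) (FT n (ft_vecs n))"
    by simp
  show ?thesis
    using assms(4)
  proof induction
    case (gen x)
    then obtain j where j: "j \<le> m" "x = s j" using assms(3) by auto
    \<comment> \<open>The largest coefficient for which the multiple of \<open>s i\<close> stays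
      below \<open>x\<close>; at \<open>i = j\<close> it is 0, so the term of \<open>s j\<close> is
      \<open>x\<close> itself.\<close>
    define c where "c = (\<lambda>i\<in>{..<Suc m}. Min ((\<lambda>l. x l - s i l) ` {..<n}))"
    have "c i + s i l \<le> x l" if "l < n" "i \<le> m" for l i
    proof -
      have "c i \<le> x l - s i l" using that by (auto simp: c_def intro: Min_le)
      then show ?thesis by simp
    qed
    moreover have "c j = 0"
    proof -
      have "(\<lambda>l. x l - s j l) ` {..<n} = {0}" using assms(1) j by (auto simp: image_constant_conv lessThan_empty_iff)
      then show ?thesis using j by (simp add: c_def)
    qed
    ultimately have "ft_comb (FT n Y) s m c = x"
      using j gen assms(2) by (intro ft_comb_FT_eqI) auto
    moreover have "c \<in> ft_vecs (Suc m)" by (simp add: c_def ft_vecs_def)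
    ultimately show ?case by blast
  next
    case (add x y)
    obtain c d where "c \<in> ft_vecs (Suc m)" "ft_comb (FT n Y) s m c = x"
      "d \<in> ft_vecs (Suc m)" "ft_comb (FT n Y) s m d = y" using add by blast
    with hom have "ft_comb (FT n Y) s m (vec_max (Suc m) c d) = vec_max n x y"
      by (auto simp: ft_hom_def)
    then show ?case by (intro bexI[of _ "vec_max (Suc m) c d"]) auto
  next
    case (scale x a)
    obtain c where "c \<in> ft_vecs (Suc m)" "ft_comb (FT n Y) s m c = x"
      using scale by blast
    with hom have "ft_comb (FT n Y) s m (vec_scale (Suc m) a c) = vec_scale n a x"
      by (auto simp: ft_hom_def)
    then show ?case by (intro bexI[of _ "vec_scale (Suc m) a c"]) auto
  qed
qed

text \<open>Expresses the order through the module addition, so that every morphism preserves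
  it.\<close>

lemma vec_le_max_iff:
  assumes "y \<in> ft_vecs n"
  shows "vec_le n x y \<longleftrightarrow> vec_max n x y = y"
proof
  assume "vec_le n x y"
  then show "vec_max n x y = y"
    using assms by (intro ft_vecs_eqI[of _ n]) (auto simp: vec_le_def)
next
  assume "vec_max n x y = y"
  then show "vec_le n x y"
    by (metis max.cobounded1 vec_apply(1) vec_le_def)
qed

lemma ft_hom_mono:
  assumes "f \<in> ft_hom (FT n X) (FT k Y)" "X \<subseteq> ft_vecs n" "Y \<subseteq> ft_vecs k"
    and "x \<in> X" "y \<in> X" "vec_le n x y"
  shows "vec_le k (f x) (f y)"
proof -
  have "vec_max n x y = y" using assms vec_le_max_iff by blast
  then have "vec_max k (f x) (f y) = f y" using ft_hom_add[OF assms(1), of x y] assms by simp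
  then show ?thesis
    using ft_hom_closed[OF assms(1), of y] assms vec_le_max_iff[of "f y" k "f x"] by auto
qed


section \<open>Projectivity over a universe type\<close>

text \<open>Transport of structure, meant for \<open>e\<close> injective on the carrier; it moves a
  module into the universe type.\<close>

definition ft_copy :: "('a \<Rightarrow> 'b) \<Rightarrow> 'a ft_struct \<Rightarrow> 'b ft_struct" where
  "ft_copy e M = (let d = inv_into (ft_carrier M) e in
     \<lparr>ft_carrier = e ` ft_carrier M, ft_add = (\<lambda>u v. e (ft_add M (d u) (d v))),
      ft_scale = (\<lambda>a u. e (ft_scale M a (d u)))\<rparr>)"

lemma ft_copy:
  assumes "ft_module M" "inj_on e (ft_carrier M)"
  shows "ft_module (ft_copy e M)" "e \<in> ft_hom M (ft_copy e M)"
    "inv_into (ft_carrier M) e \<in> ft_hom (ft_copy e M) M"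
proof -
  interpret ft_module M by fact
  have [simp]: "inv_into (ft_carrier M) e (e x) = x" if "x \<in> ft_carrier M" for x
    using assms(2) that by simp
  note [simp] = add_closed scale_closed
  show "ft_module (ft_copy e M)"
    by unfold_locales
      (auto simp: ft_copy_def Let_def scale_scale scale_max scale_add scale_0 add_assoc add_commute
        add_left_commute)
  show "e \<in> ft_hom M (ft_copy e M)" "inv_into (ft_carrier M) e \<in> ft_hom (ft_copy e M) M"
    by (auto simp: ft_copy_def Let_def ft_hom_def)
qed

text \<open>Projectivity quantifies over modules of type \<open>'u\<close> only. The lifting problem
  is copied into \<open>'u\<close> and solved there, and the solution is brought back by the inverse
  of \<open>d\<close>.\<close>

lemma ft_projective_lift:
  fixes d :: "'a \<Rightarrow> 'u" and e :: "'b \<Rightarrow> 'u"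
  assumes "ft_projective TYPE('u) P"
    and A: "ft_module A" "inj_on d (ft_carrier A)"
    and M: "ft_module M" "inj_on e (ft_carrier M)"
    and f: "f \<in> ft_hom A M" "f ` ft_carrier A = ft_carrier M"
    and g: "g \<in> ft_hom P M"
  shows "\<exists>p\<in>ft_hom P A. \<forall>x\<in>ft_carrier P. f (p x) = g x"
proof -
  let ?d = "inv_into (ft_carrier A) d"
  let ?f = "\<lambda>u. e (f (?d u))" and ?g = "\<lambda>x. e (g x)"
  have "?f ` ft_carrier (ft_copy d A) = ft_carrier (ft_copy e M)"
  proof -
    have "?f ` d ` ft_carrier A = e ` f ` ft_carrier A"
      using A(2) by (force simp: image_image)
    then show ?thesis by (simp add: ft_copy_def Let_def f(2))
  qed
  moreover have "?f \<in> ft_hom (ft_copy d A) (ft_copy e M)"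
    using ft_hom_comp[OF ft_copy(3)[OF A] ft_hom_comp[OF f(1) ft_copy(2)[OF M]]] .
  moreover have "?g \<in> ft_hom P (ft_copy e M)"
    using ft_hom_comp[OF g ft_copy(2)[OF M]] .
  ultimately obtain p where p: "p \<in> ft_hom P (ft_copy d A)" "\<forall>x\<in>ft_carrier P. ?f (p x) = ?g x"
    using assms(1) ft_copy(1)[OF A] ft_copy(1)[OF M] unfolding ft_projective_def by meson
  have q: "(\<lambda>x. ?d (p x)) \<in> ft_hom P A" using ft_hom_comp[OF p(1) ft_copy(3)[OF A]] .
  show ?thesis
  proof (intro bexI[OF _ q] ballI)
    fix x assume x: "x \<in> ft_carrier P"
    show "f (?d (p x)) = g x"
    proof (rule inj_onD[OF M(2)])
      show "?f (p x) = e (g x)" using p(2) x by blast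
    qed (use ft_hom_closed[OF f(1) ft_hom_closed[OF q x]] ft_hom_closed[OF g x] in simp_all)
  qed
qed

text \<open>Induction from a bijection between pairs of reals and reals. Hence any type into which
  the reals embed is a large enough universe for finite powers.\<close>

lemma inj_on_ft_vecs_real: "\<exists>e :: (nat \<Rightarrow> real) \<Rightarrow> real. inj_on e (ft_vecs n)"
proof (induction n)
  case 0
  then show ?case by (intro exI[of _ "\<lambda>_. 0"]) (simp add: ft_vecs_def)
next
  case (Suc n)
  then obtain e :: "(nat \<Rightarrow> real) \<Rightarrow> real" where e: "inj_on e (ft_vecs n)" by blast
  have "(card_of (UNIV \<times> UNIV :: (real \<times> real) set), card_of (UNIV :: real set)) \<in> ordIso"
    by (rule card_of_Times_same_infinite) (simp add: infinite_UNIV_char_0)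
  then obtain b :: "real \<times> real \<Rightarrow> real" where "bij_betw b (UNIV \<times> UNIV) UNIV"
    unfolding card_of_ordIso[symmetric] by blast
  then have b: "bij b" by simp
  have "inj_on (\<lambda>x. b (e (restrict x {..<n}), x n)) (ft_vecs (Suc n))"
  proof (rule inj_onI)
    fix x y assume xy: "x \<in> ft_vecs (Suc n)" "y \<in> ft_vecs (Suc n)"
      and "b (e (restrict x {..<n}), x n) = b (e (restrict y {..<n}), y n)"
    then have eq: "e (restrict x {..<n}) = e (restrict y {..<n})" and n: "x n = y n"
      using b by (auto dest: bij_is_inj injD)
    have "restrict x {..<n} = restrict y {..<n}"
      by (rule e[THEN inj_onD, OF eq]) (simp_all add: ft_vecs_def)
    then have "x i = y i" if "i < n" for i using that by (metis lessThan_iff restrict_apply')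
    then show "x = y" using n xy by (intro ft_vecs_eqI) (auto simp: less_Suc_eq)
  qed
  then show ?case by blast
qed


section \<open>Independent retracts\<close>

text \<open>\<open>p\<close> is a section of the morphism from FT^(m+1) to \<open>X\<close> given by
  the generators \<open>s j\<close>, so \<open>X\<close> is a retract of a free module;
  \<open>indep\<close> says that no generator is a combination of the others.\<close>

locale independent_retract =
  fixes n :: nat and X :: "(nat \<Rightarrow> real) set" and m :: nat
    and s :: "nat \<Rightarrow> nat \<Rightarrow> real" and p :: "(nat \<Rightarrow> real) \<Rightarrow> nat \<Rightarrow> real"
  assumes n_pos: "n \<ge> 1"
    and X_convex: "max_plus_convex n X"
    and s_in: "\<And>j. j \<le> m \<Longrightarrow> s j \<in> X"
    and p_hom: "p \<in> ft_hom (FT n X) (FT (Suc m) (ft_vecs (Suc m)))"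
    and retract: "\<And>x. x \<in> X \<Longrightarrow> ft_comb (FT n X) s m (p x) = x"
    and indep: "\<And>j. j \<le> m \<Longrightarrow> s j \<notin> ft_span (FT n X) (s ` ({..m} - {j}))"
begin

section \<open>The idempotent matrix of the retract\<close>

definition f :: "(nat \<Rightarrow> real) \<Rightarrow> nat \<Rightarrow> real" where "f = ft_comb (FT n X) s m"
text \<open>Column \<open>j\<close> is the image of \<open>s j\<close>. This is the matrix of
  \<open>p\<close> after \<open>f\<close>, an idempotent endomorphism of FT^(m+1), since
  \<open>f\<close> after \<open>p\<close> is the identity on \<open>X\<close>.\<close>

definition e :: "nat \<Rightarrow> nat \<Rightarrow> real" where "e i j = p (s j) i"

lemma X_vecs: "x \<in> X \<Longrightarrow> x \<in> ft_vecs n"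
  using X_convex by (auto simp: max_plus_convex_def)

lemma p_vecs: "x \<in> X \<Longrightarrow> p x \<in> ft_vecs (Suc m)"
  using p_hom by (auto simp: ft_hom_def)

lemma f_in: "f y \<in> X"
  unfolding f_def using ft_module.ft_comb_closed[OF ft_module_FT[OF X_convex], of m s y] s_in by simp

lemma f_hom: "f \<in> ft_hom (FT (Suc m) (ft_vecs (Suc m))) (FT n X)"
  unfolding f_def by (intro ft_comb_hom ft_module_FT X_convex) (simp add: s_in)

lemma f_p: "x \<in> X \<Longrightarrow> f (p x) = x"
  using retract by (simp add: f_def)

lemma p_f: "p (f y) = ft_comb (FT (Suc m) (ft_vecs (Suc m))) (\<lambda>j. p (s j)) m y"
  unfolding f_def using ft_module.ft_hom_comb[OF ft_module_FT[OF X_convex] p_hom] s_in by simp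

lemma p_inj: "\<lbrakk>x \<in> X; y \<in> X; p x = p y\<rbrakk> \<Longrightarrow> x = y"
  using f_p by metis

text \<open>\<open>p x\<close> is fixed by the matrix, so \<open>p x i\<close> is the maximum over
  \<open>j\<close> of the left-hand sides.\<close>

lemma e_p_le: "\<lbrakk>x \<in> X; i \<le> m; j \<le> m\<rbrakk> \<Longrightarrow> e i j + p x j \<le> p x i"
  using ft_comb_FT_ge[of j m i "Suc m" "p x" "\<lambda>j. p (s j)" "ft_vecs (Suc m)"] p_f[of "p x"] f_p[of x]
  by (simp add: e_def add.commute)

text \<open>The preceding inequality for the column \<open>p (s l)\<close>; it is one half of the
  idempotency of \<open>e\<close>.\<close>

lemma e_triangle: "\<lbrakk>i \<le> m; j \<le> m; l \<le> m\<rbrakk> \<Longrightarrow> e i j + e j l \<le> e i l"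
  using e_p_le[of "s l" i j] s_in by (simp add: e_def)

text \<open>If \<open>e j j < 0\<close>, then \<open>s j\<close> does not contribute to its own expansion and is redundant.\<close>

lemma e_diag:
  assumes j: "j \<le> m"
  shows "e j j = 0"
proof (rule ccontr)
  assume "e j j \<noteq> 0"
  then have neg: "e j j < 0" using e_triangle[OF j j j] by simp
  let ?t = "\<lambda>i. vec_scale n (e i j) (s i)"
  have comb: "ft_comb (FT n X) s m (\<lambda>i. e i j) = s j"
    using retract[OF s_in[OF j]] by (simp add: e_def)
  have att: "\<exists>i\<le>m. i \<noteq> j \<and> s j l = e i j + s i l" if "l < n" for l
    using ft_comb_FT_attained[OF that, of m X s "\<lambda>i. e i j"] neg unfolding comb by force
  then obtain i0 where i0: "i0 \<le> m" "i0 \<noteq> j" using n_pos by (metis less_eq_Suc_le One_nat_def)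
  \<comment> \<open>A sum cannot omit the index \<open>j\<close>, as there is no zero to put there;
    a second copy of the term at \<open>i0\<close> fills the place without changing the
    maximum.\<close>
  have "s j = ft_sum (FT n X) (\<lambda>i. if i = j then ?t i0 else ?t i) m"
  proof -
    have le: "e i j + s i l \<le> s j l" if "i \<le> m" "l < n" for i l
      using ft_comb_FT_ge[OF that, of "\<lambda>i. e i j" s X] unfolding comb .
    have "ft_comb (FT n X) (\<lambda>i. if i = j then s i0 else s i) m (\<lambda>i. if i = j then e i0 j else e i j)
        = s j"
    proof (rule ft_comb_FT_eqI[OF X_vecs[OF s_in[OF j]]])
      fix l assume "l < n"
      from att[OF this] obtain i where "i \<le> m" "i \<noteq> j" "s j l = e i j + s i l" by blast
      then show "\<exists>i\<le>m. s j l = (if i = j then e i0 j else e i j) + (if i = j then s i0 else s i) l"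
        by (intro exI[of _ i]) simp
    qed (use le i0 in auto)
    then show ?thesis unfolding ft_comb_def by (simp add: if_distrib cong: if_cong)
  qed
  also have "\<dots> \<in> ft_span (FT n X) (s ` ({..m} - {j}))"
    using ft_span.scale[OF ft_span.gen, of "s _" "s ` ({..m} - {j})" "FT n X"] i0
    by (intro ft_sum_in_span) auto
  finally show False using indep[OF j] by simp
qed

text \<open>With zero diagonal, \<open>y i\<close> is itself one of the terms whose maximum is entry
  \<open>i\<close> of \<open>p (f y)\<close>. So \<open>y\<close> is fixed by the matrix exactly
  when no term exceeds it, and the fixed points form the image.\<close>

lemma image_p: "p ` X = {y \<in> ft_vecs (Suc m). \<forall>i\<le>m. \<forall>j\<le>m. e i j + y j \<le> y i}"
proof (intro equalityI subsetI)
  fix y assume "y \<in> p ` X"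
  then show "y \<in> {y \<in> ft_vecs (Suc m). \<forall>i\<le>m. \<forall>j\<le>m. e i j + y j \<le> y i}"
    using e_p_le p_vecs by auto
next
  fix y assume y: "y \<in> {y \<in> ft_vecs (Suc m). \<forall>i\<le>m. \<forall>j\<le>m. e i j + y j \<le> y i}"
  have "p (f y) = y"
    unfolding p_f
  proof (rule ft_comb_FT_eqI)
    fix i assume "i < Suc m"
    then show "\<exists>j\<le>m. y i = y j + p (s j) i"
      using e_diag by (intro exI[of _ i]) (simp add: e_def)
  next
    fix i j assume "i < Suc m" "j \<le> m"
    then show "y j + p (s j) i \<le> y i" using y by (simp add: e_def add.commute)
  qed (use y in simp)
  then show "y \<in> p ` X" using f_in by (metis imageI)
qed

section \<open>Convexity and order of the image\<close>

lemma p_f_id: "y \<in> p ` X \<Longrightarrow> p (f y) = y"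
  using f_p by auto

lemma image_max_convex: "max_plus_convex (Suc m) (p ` X)"
proof -
  have "vec_max n x y \<in> X" "vec_scale n a x \<in> X" if "x \<in> X" "y \<in> X" for a x y
    using X_convex that by (auto simp: max_plus_convex_def)
  then show ?thesis
    unfolding max_plus_convex_def using p_vecs ft_hom_add[OF p_hom] ft_hom_scale[OF p_hom]
    by (auto simp flip: FT_simps) (metis FT_simps image_eqI)+
qed

text \<open>Each constraint bounds a difference of two entries from below, and this survives minima
  and scaling.\<close>

lemma image_min_convex: "min_plus_convex (Suc m) (p ` X)"
  unfolding min_plus_convex_def image_p
  by (fastforce simp: less_Suc_eq_le min_def)

lemma isomorphic_image: "ft_isomorphic (FT n X) (FT (Suc m) (p ` X))"
proof -
  have "p \<in> ft_hom (FT n X) (FT (Suc m) (p ` X))" using p_hom by (auto simp: ft_hom_def)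
  moreover have "bij_betw p X (p ` X)" using p_inj by (auto simp: bij_betw_def inj_on_def)
  ultimately show ?thesis unfolding ft_isomorphic_def by auto
qed

text \<open>Both \<open>p\<close> and \<open>f\<close> are monotone, being morphisms, and
  \<open>f\<close> undoes \<open>p\<close>.\<close>

lemma p_le_iff: "\<lbrakk>x \<in> X; y \<in> X\<rbrakk> \<Longrightarrow> vec_le (Suc m) (p x) (p y) \<longleftrightarrow> vec_le n x y"
  using ft_hom_mono[OF p_hom, of x y] ft_hom_mono[OF f_hom, of "p x" "p y"] f_p X_vecs p_vecs
  by (metis subsetI)

text \<open>\<open>p\<close> is an order isomorphism onto an image closed under componentwise
  minima, where the minimum is the greatest lower bound. This reduces \<open>dual_span\<close> to
  minima of vectors.\<close>

lemma p_glb: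
  assumes "x \<in> X" "y \<in> X"
  shows "is_glb_in n X x y z \<longleftrightarrow> z \<in> X \<and> p z = vec_min (Suc m) (p x) (p y)"
proof -
  let ?w = "vec_min (Suc m) (p x) (p y)"
  have w: "?w \<in> p ` X" using image_min_convex assms by (auto simp: min_plus_convex_def)
  have fw: "f ?w \<in> X" "p (f ?w) = ?w" using f_in p_f_id[OF w] by auto
  have le: "vec_le (Suc m) u ?w \<longleftrightarrow> vec_le (Suc m) u (p x) \<and> vec_le (Suc m) u (p y)" for u
    by (auto simp: vec_le_def)
  have glb: "is_glb_in n X x y (f ?w)"
    unfolding is_glb_in_def
  proof (intro conjI ballI impI)
    have "vec_le (Suc m) ?w ?w" by (simp add: vec_le_def)
    then show "vec_le n (f ?w) x" "vec_le n (f ?w) y"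
      using le[of ?w] fw p_le_iff[OF fw(1)] assms by metis+
    fix u assume "u \<in> X" "vec_le n u x \<and> vec_le n u y"
    then show "vec_le n u (f ?w)"
      using le[of "p u"] fw p_le_iff[of u] assms by metis
  qed (rule fw(1))
  have "z = f ?w" if "is_glb_in n X x y z"
  proof -
    have "vec_le n z (f ?w)" "vec_le n (f ?w) z" "z \<in> X"
      using glb that by (auto simp: is_glb_in_def)
    then show ?thesis using X_vecs f_in
      by (intro ft_vecs_eqI[of _ n]) (auto simp: vec_le_def intro: antisym)
  qed
  then show ?thesis using fw glb p_inj by metis
qed

text \<open>For \<open>y i = 0\<close> the constraints with first index \<open>i\<close> read
  \<open>y j \<le> - e i j\<close>; the negated row collects these upper bounds.\<close>

definition r :: "nat \<Rightarrow> nat \<Rightarrow> real" where "r i = (\<lambda>j\<in>{..<Suc m}. - e i j)"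

lemma r_apply [simp]: "j \<le> m \<Longrightarrow> r i j = - e i j"
  by (simp add: r_def)

text \<open>Membership is the triangle inequality \<open>e i j + e j l \<le> e i l\<close>,
  rearranged.\<close>

lemma r_in:
  assumes "i \<le> m"
  shows "r i \<in> p ` X"
proof -
  have "e j l + r i l \<le> r i j" if "j \<le> m" "l \<le> m" for j l
    using e_triangle[OF assms that] that by simp
  then show ?thesis by (auto simp: image_p) (simp add: r_def ft_vecs_def)
qed

section \<open>Generators under greatest lower bounds\<close>

lemma dual_span_le: "T \<subseteq> X \<Longrightarrow> dual_span n X T \<subseteq> X"
proof
  fix x assume "T \<subseteq> X" "x \<in> dual_span n X T"
  from this(2,1) show "x \<in> X"
    using X_convex by induction (auto simp: is_glb_in_def max_plus_convex_def)
qed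

text \<open>\<open>p x\<close> is the minimum of the rows \<open>r i\<close> scaled by
  \<open>p x i\<close>: each lies above \<open>p x\<close> by \<open>e_p_le\<close>, and the one
  with \<open>i = j\<close> attains entry \<open>j\<close> because \<open>e j j = 0\<close>.\<close>

lemma dual_span_rows: "dual_span n X ((\<lambda>i. f (r i)) ` {..m}) = X"
proof
  let ?T = "(\<lambda>i. f (r i)) ` {..m}"
  show sub: "dual_span n X ?T \<subseteq> X" using f_in by (intro dual_span_le) auto
  show "X \<subseteq> dual_span n X ?T"
  proof
    fix x assume x: "x \<in> X"
    have row: "\<exists>z\<in>dual_span n X ?T. \<forall>j\<le>m. p z j = p x i - e i j" if "i \<le> m" for i
    proof
      show "vec_scale n (p x i) (f (r i)) \<in> dual_span n X ?T"
        using that by (intro dual_span.scale[OF dual_span.gen]) auto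
      show "\<forall>j\<le>m. p (vec_scale n (p x i) (f (r i))) j = p x i - e i j"
        using ft_hom_scale[OF p_hom, of "f (r i)"] f_in p_f_id[OF r_in[OF that]] by simp
    qed
    \<comment> \<open>Greatest lower bounds are binary, so the minimum is built up over the rows
      \<open>0\<close> to \<open>l\<close>; \<open>z\<close> is described entrywise as a lower bound
      that is attained.\<close>
    have "\<exists>z\<in>dual_span n X ?T. \<forall>j\<le>m. (\<forall>i\<le>l. p z j \<le> p x i - e i j) \<and> (\<exists>i\<le>l. p z j = p x i - e i j)"
      if "l \<le> m" for l
      using that
    proof (induction l)
      case 0
      obtain z where "z \<in> dual_span n X ?T" "\<forall>j\<le>m. p z j = p x 0 - e 0 j"
        using row[of 0] by blast
      then show ?case by (intro bexI[of _ z]) auto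
    next
      case (Suc l)
      then obtain z where z: "z \<in> dual_span n X ?T"
        "\<forall>j\<le>m. (\<forall>i\<le>l. p z j \<le> p x i - e i j) \<and> (\<exists>i\<le>l. p z j = p x i - e i j)" by auto
      obtain y where y: "y \<in> dual_span n X ?T" "\<forall>j\<le>m. p y j = p x (Suc l) - e (Suc l) j"
        using row[OF Suc.prems] by blast
      have zy: "z \<in> X" "y \<in> X" using z y sub by auto
      have "vec_min (Suc m) (p z) (p y) \<in> p ` X"
        using image_min_convex zy by (auto simp: min_plus_convex_def)
      then obtain w where w: "w \<in> X" "p w = vec_min (Suc m) (p z) (p y)" by auto
      then have "w \<in> dual_span n X ?T"
        using p_glb[OF zy] z(1) y(1) by (blast intro: dual_span.glb)
      moreover have "(\<forall>i\<le>Suc l. p w j \<le> p x i - e i j) \<and> (\<exists>i\<le>Suc l. p w j = p x i - e i j)"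
        if j: "j \<le> m" for j
      proof -
        have pw: "p w j = min (p z j) (p x (Suc l) - e (Suc l) j)" using w y j by simp
        obtain i where i: "i \<le> l" "p z j = p x i - e i j" using z(2) j by blast
        have "\<exists>i\<le>Suc l. p w j = p x i - e i j"
        proof (cases "p z j \<le> p x (Suc l) - e (Suc l) j")
          case True
          then show ?thesis using pw i by (intro exI[of _ i]) simp
        next
          case False
          then show ?thesis using pw by (intro exI[of _ "Suc l"]) simp
        qed
        moreover have "\<forall>i\<le>Suc l. p w j \<le> p x i - e i j"
          using pw z(2) j by (auto simp: le_Suc_eq intro: min.coboundedI1)
        ultimately show ?thesis by blast
      qed
      ultimately show ?case by blast
    qed
    from this[OF order_refl] obtain z where z: "z \<in> dual_span n X ?T"
      "\<forall>j\<le>m. (\<forall>i\<le>m. p z j \<le> p x i - e i j) \<and> (\<exists>i\<le>m. p z j = p x i - e i j)" by blast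
    have "p z j = p x j" if "j \<le> m" for j
    proof (rule antisym)
      note zj = z(2)[rule_format, OF that]
      show "p z j \<le> p x j" using conjunct1[OF zj, rule_format, OF that] e_diag[OF that] by simp
      from conjunct2[OF zj] obtain i where "i \<le> m" "p z j = p x i - e i j" by auto
      then show "p x j \<le> p z j" using e_p_le[OF x, of i j] that by simp
    qed
    then have "p z = p x" using p_vecs x z(1) sub by (intro ft_vecs_eqI) auto
    then show "x \<in> dual_span n X ?T" using p_inj x z(1) sub by blast
  qed
qed

text \<open>
  The vector \<open>r i\<close> is the greatest element of \<open>p ` X\<close> with \<open>i\<close>-th entry \<open>0\<close>. Hence if it is the
  minimum of two elements, it equals the one that has \<open>i\<close>-th entry \<open>0\<close>.
\<close>

lemma r_irreducible:
  assumes "i \<le> m" "x \<in> X" "vec_le (Suc m) (vec_scale (Suc m) c (r i)) (p x)" "p x i = c"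
  shows "p x = vec_scale (Suc m) c (r i)"
proof (rule ft_vecs_eqI[OF p_vecs[OF assms(2)]])
  fix j assume "j < Suc m"
  then show "p x j = vec_scale (Suc m) c (r i) j"
    using assms(3,4) e_p_le[OF assms(2,1), of j] by (fastforce simp: vec_le_def)
qed simp

text \<open>A derivation of a multiple of \<open>r i\<close> is traced back to a generator: a
  greatest lower bound equal to such a multiple already has it as one of its arguments, and scaling
  only changes the factor.\<close>

lemma dual_span_contains_row:
  assumes "x \<in> dual_span n X T" "T \<subseteq> X" "i \<le> m" "p x = vec_scale (Suc m) c (r i)"
  shows "\<exists>t\<in>T. \<exists>c. p t = vec_scale (Suc m) c (r i)"
  using assms
proof (induction arbitrary: c)
  case (gen x)
  then show ?case by blast
next
  case (glb x y z)
  have xy: "x \<in> X" "y \<in> X" using glb dual_span_le by blast+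
  then have z: "p z = vec_min (Suc m) (p x) (p y)" using glb p_glb by blast
  \<comment> \<open>The factor is entry \<open>i\<close>, where the row vanishes; the argument that
    attains the minimum there satisfies the premises of \<open>r_irreducible\<close>.\<close>
  have "p z i = c" using glb.prems e_diag by simp
  moreover have "p z i = p x i \<or> p z i = p y i" using z \<open>i \<le> m\<close> by (auto simp: min_def)
  moreover have "vec_le (Suc m) (p z) (p x)" "vec_le (Suc m) (p z) (p y)"
    using z by (auto simp: vec_le_def)
  ultimately show ?case
    using glb.prems glb.IH r_irreducible[OF \<open>i \<le> m\<close>] xy by metis
next
  case (scale x a)
  have x: "x \<in> X" using scale dual_span_le by blast
  have "p x = vec_scale (Suc m) (c - a) (r i)"
  proof (rule ft_vecs_eqI[OF p_vecs[OF x]])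
    fix j assume j: "j < Suc m"
    have "vec_scale (Suc m) a (p x) = vec_scale (Suc m) c (r i)"
      using ft_hom_scale[OF p_hom, of x a] x scale.prems by simp
    from fun_cong[OF this, of j] show "p x j = vec_scale (Suc m) (c - a) (r i) j"
      using j by simp
  qed simp
  then show ?case using scale by blast
qed

text \<open>Comparing entries \<open>i\<close> and \<open>j\<close> of the rows gives
  \<open>e i j + e j i = 0\<close>. The triangle inequalities through \<open>i\<close> and through
  \<open>j\<close> then make columns \<open>i\<close> and \<open>j\<close> proportional, hence also
  \<open>s i\<close> and \<open>s j\<close>, against independence.\<close>

lemma rows_not_proportional:
  assumes "i \<le> m" "j \<le> m" "vec_scale (Suc m) c (r i) = vec_scale (Suc m) d (r j)"
  shows "i = j"
proof (rule ccontr)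
  assume "i \<noteq> j"
  have "c - e i l = d - e j l" if "l \<le> m" for l
    using fun_cong[OF assms(3), of l] that by simp
  from this[of i] this[of j] have e: "e j i = d - c" "e i j = c - d"
    using assms e_diag by auto
  have sj: "vec_scale n (e j i) (s j) \<in> X"
    using X_convex s_in[OF assms(2)] by (auto simp: max_plus_convex_def)
  have "p (s i) = p (vec_scale n (e j i) (s j))"
  proof (rule ft_vecs_eqI[OF p_vecs[OF s_in[OF assms(1)]] p_vecs[OF sj]])
    fix l assume "l < Suc m"
    then have "e l i = e j i + e l j" using e_triangle[of l i j] e_triangle[of l j i] e assms by simp
    then show "p (s i) l = p (vec_scale n (e j i) (s j)) l"
      using ft_hom_scale[OF p_hom, of "s j"] s_in assms \<open>l < Suc m\<close> by (simp add: e_def)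
  qed
  then have "s i = vec_scale n (e j i) (s j)"
    by (rule p_inj[OF s_in[OF assms(1)] sj])
  moreover have "vec_scale n (e j i) (s j) \<in> ft_span (FT n X) (s ` ({..m} - {i}))"
    using ft_span.scale[OF ft_span.gen, of "s j" "s ` ({..m} - {i})" "FT n X"] assms \<open>i \<noteq> j\<close>
    by simp
  ultimately show False using indep[OF assms(1)] by simp
qed

text \<open>Every row has a multiple among the images of \<open>T\<close>, and no member of
  \<open>T\<close> serves two rows, as rows are not proportional.\<close>

lemma card_dual_generators:
  assumes "finite T" "T \<subseteq> X" "dual_span n X T = X"
  shows "Suc m \<le> card T"
proof -
  have "\<exists>t\<in>T. \<exists>c. p t = vec_scale (Suc m) c (r i)" if "i \<le> m" for i
  proof (rule dual_span_contains_row[OF _ assms(2) that])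
    show "f (r i) \<in> dual_span n X T" using f_in assms by simp
    show "p (f (r i)) = vec_scale (Suc m) 0 (r i)"
      unfolding p_f_id[OF r_in[OF that]]
    proof (rule ft_vecs_eqI)
      show "r i \<in> ft_vecs (Suc m)" by (simp add: r_def ft_vecs_def)
    qed simp_all
  qed
  then obtain t c where t: "\<And>i. i \<le> m \<Longrightarrow> t i \<in> T \<and> p (t i) = vec_scale (Suc m) (c i) (r i)"
    by metis
  have "inj_on t {..m}"
    using t rows_not_proportional by (intro inj_onI) (metis atMost_iff)
  then have "card {..m} \<le> card T"
    using t assms(1) by (intro card_inj_on_le) auto
  then show ?thesis by simp
qed

lemma dual_dim_eq: "dual_dim n X = enat (Suc m)"
proof (rule antisym)
  let ?T = "(\<lambda>i. f (r i)) ` {..m}"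
  have "dual_dim n X \<le> enat (card ?T)"
    unfolding dual_dim_def using dual_span_rows f_in by (intro INF_lower) auto
  also have "\<dots> \<le> enat (Suc m)" using card_image_le[of "{..m}" "\<lambda>i. f (r i)"] by simp
  finally show "dual_dim n X \<le> enat (Suc m)" .
  show "enat (Suc m) \<le> dual_dim n X"
    unfolding dual_dim_def using card_dual_generators by (intro INF_greatest) simp
qed

end


section \<open>Characterization of projectivity\<close>

lemma min_plus_convex_finite_min:
  assumes "min_plus_convex k Y" "finite T" "T \<noteq> {}" "T \<subseteq> Y"
  shows "\<exists>z\<in>Y. \<forall>i<k. (\<forall>t\<in>T. z i \<le> t i) \<and> (\<exists>t\<in>T. z i = t i)"
  using assms(2-4)
proof (induction rule: finite_ne_induct)
  case (insert t T)
  then obtain z where z: "z \<in> Y" "\<forall>i<k. (\<forall>t\<in>T. z i \<le> t i) \<and> (\<exists>t\<in>T. z i = t i)" by auto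
  have "vec_min k t z \<in> Y" using assms(1) z insert.prems by (auto simp: min_plus_convex_def)
  moreover have "(\<forall>u\<in>insert t T. vec_min k t z i \<le> u i) \<and> (\<exists>u\<in>insert t T. vec_min k t z i = u i)"
    if "i < k" for i
  proof -
    have "\<exists>u\<in>T. z i = u i" using z(2) that by blast
    then show ?thesis using z(2) that by (auto simp: min_def intro: order_trans)
  qed
  ultimately show ?case by blast
qed auto

text \<open>\<open>c\<close> is the componentwise minimum of the generators, each normalized to have
  entry \<open>j\<close> equal to 0. The inequality, clear on generators, passes to maxima and
  multiples. \<open>M\<close> and \<open>h\<close> are carried along because the generators are
  given in \<open>M\<close>.\<close>

lemma exists_least_normalized:
  assumes Y: "max_plus_convex k Y" "min_plus_convex k Y"
    and h: "h \<in> ft_hom M (FT k Y)" "h ` ft_carrier M = Y"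
    and S: "finite S" "S \<noteq> {}" "S \<subseteq> ft_carrier M" "ft_span M S = ft_carrier M"
    and "j < k"
  shows "\<exists>c\<in>Y. c j = 0 \<and> (\<forall>y\<in>Y. \<forall>i<k. c i + y j \<le> y i)"
proof -
  let ?T = "(\<lambda>s. vec_scale k (- h s j) (h s)) ` S"
  have hS: "h s \<in> Y" if "s \<in> S" for s using ft_hom_closed[OF h(1)] S(3) that by auto
  then have "?T \<subseteq> Y" using Y(1) by (auto simp: max_plus_convex_def)
  from min_plus_convex_finite_min[OF Y(2) _ _ this] S obtain c where
    c: "c \<in> Y" "\<forall>i<k. (\<forall>t\<in>?T. c i \<le> t i) \<and> (\<exists>t\<in>?T. c i = t i)"
    by auto
  have "c i + h x j \<le> h x i" if "x \<in> ft_span M S" "i < k" for x i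
    using that
  proof induction
    case (gen s)
    then have "c i \<le> vec_scale k (- h s j) (h s) i" using c(2) by blast
    then show ?case using gen by simp
  next
    case (add x y)
    then have "h (ft_add M x y) = vec_max k (h x) (h y)"
      using ft_hom_add[OF h(1)] S(4) by simp
    then show ?case using add \<open>j < k\<close> by (auto simp: max_def)
  next
    case (scale x a)
    then have "h (ft_scale M a x) = vec_scale k a (h x)"
      using ft_hom_scale[OF h(1)] S(4) by simp
    then show ?case using scale \<open>j < k\<close> by simp
  qed
  then have "\<forall>y\<in>Y. \<forall>i<k. c i + y j \<le> y i" using h(2) S(4) by blast
  moreover have "c j = 0" using c(2) \<open>j < k\<close> by auto
  ultimately show ?thesis using c(1) by blast
qed

lemma ft_projective_if_isomorphic:
  assumes M: "ft_module M" "finite S" "S \<noteq> {}" "S \<subseteq> ft_carrier M" "ft_span M S = ft_carrier M"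
    and Y: "max_plus_convex (Suc m) Y" "min_plus_convex (Suc m) Y"
    and iso: "ft_isomorphic M (FT (Suc m) Y)"
  shows "ft_projective TYPE('u) M"
proof -
  obtain h where h: "h \<in> ft_hom M (FT (Suc m) Y)" "bij_betw h (ft_carrier M) Y"
    using iso by (auto simp: ft_isomorphic_def)
  have hY: "h ` ft_carrier M = Y" using h(2) by (simp add: bij_betw_def)
  have "\<exists>c\<in>Y. c j = 0 \<and> (\<forall>y\<in>Y. \<forall>i<Suc m. c i + y j \<le> y i)" if "j \<le> m" for j
    using exists_least_normalized[OF Y h(1) hY M(2-5)] that by simp
  then obtain c where c: "\<And>j. j \<le> m \<Longrightarrow> c j \<in> Y \<and> c j j = 0 \<and> (\<forall>y\<in>Y. \<forall>i<Suc m. c j i + y j \<le> y i)"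
    by metis
  then have "\<exists>b\<in>ft_carrier M. h b = c j" if "j \<le> m" for j using hY that by (metis imageE)
  then obtain b where b: "\<And>j. j \<le> m \<Longrightarrow> b j \<in> ft_carrier M \<and> h (b j) = c j" by metis
  \<comment> \<open>No term exceeds \<open>h x\<close>, and the term at \<open>j = i\<close> attains
    entry \<open>i\<close> since \<open>c i i = 0\<close>; so \<open>M\<close> is a retract of the
    free module.\<close>
  have expand: "ft_comb M b m (h x) = x" if x: "x \<in> ft_carrier M" for x
  proof -
    have hx: "h x \<in> Y" using hY x by blast
    have "h (ft_comb M b m (h x)) = ft_comb (FT (Suc m) Y) (\<lambda>j. h (b j)) m (h x)"
      using ft_module.ft_hom_comb[OF M(1) h(1)] b by blast
    also have "\<dots> = h x"
    proof (rule ft_comb_FT_eqI)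
      show "h x \<in> ft_vecs (Suc m)" using hx Y(1) by (auto simp: max_plus_convex_def)
      fix i assume i: "i < Suc m"
      show "\<exists>j\<le>m. h x i = h x j + h (b j) i" using b c i by (intro exI[of _ i]) auto
      show "h x j + h (b j) i \<le> h x i" if "j \<le> m" for j
        using b[OF that] c[OF that] hx i by (simp add: add.commute[of "h x j"])
    qed
    finally show ?thesis
      using h(2) x ft_module.ft_comb_closed[OF M(1)] b by (metis bij_betw_def inj_onD)
  qed
  show ?thesis
    unfolding ft_projective_def
  proof (intro conjI allI impI M(1))
    fix A N :: "'u ft_struct" and f g
    assume *: "ft_module A \<and> ft_module N \<and> g \<in> ft_hom M N \<and> f \<in> ft_hom A N
      \<and> f ` ft_carrier A = ft_carrier N"
    then have "\<exists>a\<in>ft_carrier A. f a = g (b j)" if "j \<le> m" for j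
      using b[OF that] ft_hom_closed[of g M N] by (metis imageE)
    then obtain a where a: "\<And>j. j \<le> m \<Longrightarrow> a j \<in> ft_carrier A \<and> f (a j) = g (b j)" by metis
    \<comment> \<open>The coefficients \<open>h x\<close> depend on \<open>x\<close> by a morphism,
      so any choice of the \<open>a j\<close> gives a morphism.\<close>
    have "(\<lambda>x. ft_comb A a m (h x)) \<in> ft_hom M A"
      using * a by (intro ft_hom_comp[OF h(1)] ft_comb_hom) auto
    then show "\<exists>p\<in>ft_hom M A. \<forall>x\<in>ft_carrier M. f (p x) = g x"
    proof (rule bexI[rotated], intro ballI)
      fix x assume x: "x \<in> ft_carrier M"
      have "f (ft_comb A a m (h x)) = ft_comb N (\<lambda>j. f (a j)) m (h x)"
        using * a ft_module.ft_hom_comb by blast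
      also have "\<dots> = ft_comb N (\<lambda>j. g (b j)) m (h x)"
        unfolding ft_comb_def using a by (intro ft_sum_cong) simp
      also have "\<dots> = g (ft_comb M b m (h x))"
        using * b ft_module.ft_hom_comb[OF M(1), of g N m b] by simp
      finally show "f (ft_comb A a m (h x)) = g x" using expand[OF x] by simp
    qed
  qed
qed

section \<open>Minimal generating sets and lifts of the identity\<close>

lemma generator_dim_attained:
  assumes "finite S" "S \<subseteq> ft_carrier M" "ft_span M S = ft_carrier M"
  obtains T where "finite T" "T \<subseteq> ft_carrier M" "ft_span M T = ft_carrier M"
    "generator_dim M = enat (card T)"
proof -
  let ?A = "{S. finite S \<and> S \<subseteq> ft_carrier M \<and> ft_span M S = ft_carrier M}"
  have "generator_dim M \<in> (\<lambda>S. enat (card S)) ` ?A"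
    unfolding generator_dim_def using assms by (intro wellorder_InfI[of "enat (card S)"]) auto
  then show ?thesis using that by auto
qed

lemma generator_dim_le:
  assumes "finite S" "S \<subseteq> ft_carrier M" "ft_span M S = ft_carrier M"
  shows "generator_dim M \<le> enat (card S)"
  unfolding generator_dim_def using assms by (intro INF_lower) auto

lemma independent_retract_if_projective:
  fixes \<iota> :: "real \<Rightarrow> 'u"
  assumes "inj \<iota>" "n \<ge> 1" and X: "tropical_polytope n X"
    and proj: "ft_projective TYPE('u) (FT n X)"
  shows "\<exists>m s p. independent_retract n X m s p \<and> generator_dim (FT n X) = enat (Suc m)"
proof -
  from X have Xc: "max_plus_convex n X" and "X \<noteq> {}" by (auto simp: tropical_polytope_def)
  from X obtain T where T: "finite T" "T \<subseteq> X" "ft_span (FT n X) T = X"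
    "generator_dim (FT n X) = enat (card T)"
    by (metis generator_dim_attained tropical_polytope_def FT_simps(1))
  have "T \<noteq> {}" using T(3) \<open>X \<noteq> {}\<close> ft_span_empty by metis
  then obtain m where m: "card T = Suc m" using T(1) by (metis card_0_eq not0_implies_Suc)
  then obtain s where s: "bij_betw s {..m} T"
    using T(1) by (metis ex_bij_betw_nat_finite atLeast0LessThan lessThan_Suc_atMost)
  have sT: "T = s ` {..m}" using s by (simp add: bij_betw_def)
  have sX: "s j \<in> X" if "j \<le> m" for j using that sT T(2) by auto
  have Xv: "X \<subseteq> ft_vecs n" using Xc by (simp add: max_plus_convex_def)
  let ?F = "FT (Suc m) (ft_vecs (Suc m))" and ?f = "ft_comb (FT n X) s m"
  have f: "?f \<in> ft_hom ?F (FT n X)"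
    using sX by (intro ft_comb_hom ft_module_FT Xc) auto
  moreover have "?f ` ft_carrier ?F = ft_carrier (FT n X)"
  proof
    show "?f ` ft_carrier ?F \<subseteq> ft_carrier (FT n X)" using ft_hom_closed[OF f] by auto
    show "ft_carrier (FT n X) \<subseteq> ?f ` ft_carrier ?F"
    proof
      fix x assume "x \<in> ft_carrier (FT n X)"
      then have "x \<in> ft_span (FT n X) T" using T(3) by simp
      then obtain c where "c \<in> ft_vecs (Suc m)" "?f c = x"
        using span_FT_comb[OF \<open>n \<ge> 1\<close> _ sT] T(2) Xv by blast
      then show "x \<in> ?f ` ft_carrier ?F" by auto
    qed
  qed
  \<comment> \<open>The carriers of the free module and of \<open>X\<close> reach the universe type
    in two steps, by way of the reals.\<close>
  moreover obtain d e :: "(nat \<Rightarrow> real) \<Rightarrow> real" where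
    de: "inj_on d (ft_vecs (Suc m))" "inj_on e (ft_vecs n)"
    using inj_on_ft_vecs_real by metis
  have "inj_on (\<lambda>x. \<iota> (d x)) (ft_carrier ?F)" "inj_on (\<lambda>x. \<iota> (e x)) (ft_carrier (FT n X))"
    using de(1) inj_on_subset[OF de(2) Xv] \<open>inj \<iota>\<close> by (simp_all add: inj_on_def)
  moreover have "(\<lambda>x. x) \<in> ft_hom (FT n X) (FT n X)" by (simp add: ft_hom_def)
  ultimately obtain p where p: "p \<in> ft_hom (FT n X) ?F" "\<forall>x\<in>X. ?f (p x) = x"
    using ft_projective_lift[OF proj ft_module_FT[OF max_plus_convex_ft_vecs[of "Suc m"]] _ ft_module_FT[OF Xc],
        of "\<lambda>x. \<iota> (d x)" "\<lambda>x. \<iota> (e x)" ?f "\<lambda>x. x"] by auto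
  \<comment> \<open>If \<open>s j\<close> were redundant, the remaining generators, at most
    \<open>m\<close> of them, would span \<open>X\<close>, against the minimality of
    \<open>T\<close>.\<close>
  have "s j \<notin> ft_span (FT n X) (s ` ({..m} - {j}))" if j: "j \<le> m" for j
  proof
    let ?R = "s ` ({..m} - {j})"
    assume *: "s j \<in> ft_span (FT n X) ?R"
    have "T \<subseteq> ft_span (FT n X) ?R"
      unfolding sT using * by (auto intro: ft_span.gen)
    then have "X \<subseteq> ft_span (FT n X) ?R" using ft_span_subset T(3) by metis
    moreover have "ft_span (FT n X) ?R \<subseteq> ft_span (FT n X) T"
      unfolding sT by (intro ft_span_subset) (auto intro: ft_span.gen)
    ultimately have "generator_dim (FT n X) \<le> enat (card ?R)"
      using T(3) sX by (intro generator_dim_le) auto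
    moreover have "card ?R \<le> m"
      using card_image_le[of "{..m} - {j}" s] j by simp
    ultimately show False using T(4) m by simp
  qed
  then have "independent_retract n X m s p"
    using \<open>n \<ge> 1\<close> Xc sX p by unfold_locales auto
  then show ?thesis using T(4) m by auto
qed

text \<open>Any universe that contains a copy of the reals tests projectivity: the right-hand side
  does not mention \<open>'u\<close> and, by \<open>ft_projective_if_isomorphic\<close>, gives the
  lifting property over every type.\<close>

theorem theorem1p5:
  fixes n :: nat and X :: "(nat \<Rightarrow> real) set"
    and \<iota> :: "real \<Rightarrow> 'u"
  assumes "inj \<iota>"
    and "n \<ge> 1"
    and "tropical_polytope n X"
  shows "ft_projective TYPE('u) (FT n X) \<longleftrightarrow>
    (\<exists>k::nat. generator_dim (FT n X) = enat k \<and> dual_dim n X = enat k \<and>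
       (\<exists>Y. max_plus_convex k Y \<and> min_plus_convex k Y \<and> ft_isomorphic (FT n X) (FT k Y)))"
    (is "?proj \<longleftrightarrow> ?dims")
proof
  assume ?proj
  then obtain m s p where R: "independent_retract n X m s p"
    and "generator_dim (FT n X) = enat (Suc m)"
    using independent_retract_if_projective[OF assms] by blast
  then show ?dims
    using independent_retract.dual_dim_eq[OF R] independent_retract.image_max_convex[OF R]
      independent_retract.image_min_convex[OF R] independent_retract.isomorphic_image[OF R] by blast
next
  assume ?dims
  then obtain k Y where k: "generator_dim (FT n X) = enat k"
    and Y: "max_plus_convex k Y" "min_plus_convex k Y" "ft_isomorphic (FT n X) (FT k Y)" by blast
  from assms(3) have "X \<noteq> {}" and X: "ft_module (FT n X)"
    by (auto simp: tropical_polytope_def ft_module_FT)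
  from assms(3) obtain T where T: "finite T" "T \<subseteq> X" "ft_span (FT n X) T = X"
    "generator_dim (FT n X) = enat (card T)"
    by (metis generator_dim_attained tropical_polytope_def FT_simps(1))
  have "T \<noteq> {}" using T(3) \<open>X \<noteq> {}\<close> ft_span_empty by metis
  then obtain m where "k = Suc m" using T(1,4) k by (metis card_0_eq enat.inject not0_implies_Suc)
  then show ?proj
    using ft_projective_if_isomorphic[OF X T(1) \<open>T \<noteq> {}\<close>, of m Y] T Y by simp
qed

end
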